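(* Let $n\in\mathbb{N}$ be arbitrary (with $n\gg k$), and let $k$ with $\frac{k}{2}\in\mathbb{N}$ and $p\in[0,1]$ be fixed. Let $A_n$ be the adjacency matrix of the small-world random graph $SW(n,k,p)$. Then the limiting third moment of the eigenvalue distribution is $$\lim_{n\to\infty}\mathbb{E}\Big[\frac{1}{n}\mathrm{Tr}(A_n^3)\Big] = \frac{3k(k-2)(1-p)^3}{4}.$$
   Context: The small-world (Watts-Strogatz) random graph $SW(n,k,p)$, with parameters $n\in\mathbb{N}$ (number of vertices), $k\in 2\mathbb{N}$ (degree of the initial lattice) and $p\in[0,1]$ (rewiring probability), where it is assumed that $n\gg k$, is constructed as follows. The vertex set is $\{1,\dots,n\}$, and $i\pm d$ is read modulo $n$. Start from the undirected regular ring lattice of degree $k$, in which each vertex $i$ is adjacent exactly to $i\pm 1,\dots,i\pm\frac{k}{2}$. Consider the vertices $i=1,2,\dots,n$ in order, each once, and for each $i$ consider the edges $\{i,j\}$ for $j=i+1,i+2,\dots,i+\frac{k}{2}$ in order. With probability $1-p$ the edge $\{i,j\}$ is kept; otherwise (with probability $p$, independently) a vertex $j'$ is chosen uniformly at random from $\{1,\dots,n\}\setminus\big(\{i-\frac{k}{2},\dots,i-1,i,i+1,\dots,i+\frac{k}{2}\}\cup\mathbf{N}(i)\big)$, where $\mathbf{N}(i)$ is the set of all vertices $v$ such that the edge $\{i,v\}$ is in the graph, and the edge $\{i,j\}$ is replaced by $\{i,j'\}$. The output is $SW(n,k,p)$. The adjacency matrix $A_n=(A_{ij})$ is the $n\times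 n$ matrix with $A_{ij}=1$ if the edge $\{i,j\}$ is in the graph and $A_{ij}=0$ otherwise. $\mathrm{Tr}$ denotes the trace and $\mathbb{E}$ the expectation over the random graph; $\frac1n\mathrm{Tr}(A_n^3)=\frac1n\sum_{i=1}^n\lambda_i^3$, where $\lambda_1,\dots,\lambda_n$ are the eigenvalues of $A_n$. *)

theory Defs
  imports "HOL-Probability.Probability" "Jordan_Normal_Form.Matrix"
begin

text \<open>The vertices are the integers \<open>1, \<dots>, n\<close>; an undirected graph is its set of edges \<open>{u, v}\<close>.\<close>

definition vertices :: "nat \<Rightarrow> int set" where
  "vertices n = {1..int n}"

text \<open>The representative modulo \<open>n\<close> of an integer in \<open>{1, \<dots>, n}\<close>.\<close>

definition wrap :: "nat \<Rightarrow> int \<Rightarrow> int" where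
  "wrap n x = (x - 1) mod int n + 1"

definition ring_lattice :: "nat \<Rightarrow> nat \<Rightarrow> int set set" where
  "ring_lattice n k = {{i, wrap n (i + d)} | i d. i \<in> vertices n \<and> d \<in> {1..int (k div 2)}}"

definition lattice_window :: "nat \<Rightarrow> nat \<Rightarrow> int \<Rightarrow> int set" where
  "lattice_window n k i = (\<lambda>d. wrap n (i + d)) ` {- int (k div 2)..int (k div 2)}"

definition nbrs :: "nat \<Rightarrow> int set set \<Rightarrow> int \<Rightarrow> int set" where
  "nbrs n G i = {v \<in> vertices n. {i, v} \<in> G}"

definition candidates :: "nat \<Rightarrow> nat \<Rightarrow> int set set \<Rightarrow> int \<Rightarrow> int set" where
  "candidates n k G i = vertices n - (lattice_window n k i \<union> nbrs n G i)"

text \<open>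
  The step that treats the lattice edge \<open>{i, j}\<close>, \<open>j = i + d\<close>, in the current graph \<open>G\<close>.
  The construction leaves open what happens when an edge is to be rewired but no new
  endpoint is available; the edge is then kept.
\<close>

definition rewire_step :: "nat \<Rightarrow> nat \<Rightarrow> real \<Rightarrow> int \<Rightarrow> int \<Rightarrow> int set set \<Rightarrow> int set set pmf" where
  "rewire_step n k p i d G =
     bind_pmf (bernoulli_pmf p) (\<lambda>rewire.
       if rewire \<and> candidates n k G i \<noteq> {}
       then map_pmf (\<lambda>j'. insert {i, j'} (G - {{i, wrap n (i + d)}}))
              (pmf_of_set (candidates n k G i))
       else return_pmf G)"

text \<open>\<open>List.product\<close> runs through the pairs \<open>(i, d)\<close> in lexicographic order.\<close>

definition small_world :: "nat \<Rightarrow> nat \<Rightarrow> real \<Rightarrow> int set set pmf" where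
  "small_world n k p =
     fold (\<lambda>(i, d) M. bind_pmf M (rewire_step n k p i d))
       (List.product [1..int n] [1..int (k div 2)])
       (return_pmf (ring_lattice n k))"

text \<open>Matrix indices start at \<open>0\<close>: row and column \<open>i\<close> belong to the vertex \<open>i + 1\<close>.\<close>

definition adjacency_matrix :: "nat \<Rightarrow> int set set \<Rightarrow> real mat" where
  "adjacency_matrix n G = mat n n (\<lambda>(i, j). if {int i + 1, int j + 1} \<in> G then 1 else 0)"

definition mat_trace :: "'a :: comm_monoid_add mat \<Rightarrow> 'a" where
  "mat_trace A = (\<Sum>i<dim_row A. A $$ (i, i))"

end

(* Proof idea. A rewired edge is never a lattice edge, because the lattice window is excluded
   from the candidates. So the lattice edges that survive are governed by the coin flips alone: three
   fixed ones all survive with probability (1 - p)^3, up to the probability that some vertex has no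
   candidates. Every vertex is the first corner of 3 m (m - 1) ordered lattice triangles, m = k / 2.

   The triangles that use a rewired edge are negligible. The j' of a new edge {i, j'} is
   nearly uniform, so it closes about (1/n) * (number of 2-walks from i) triangles, and it remains
   to bound the sum of the squared degrees by O(n), which the same averaging gives. The
   number of candidates is smaller than n / 2 only if deg i is of order n; this event is absorbed by
   1[card C < n/2] <= 2 (2 m + 1 + deg i) / n. All errors sum to O(1), hence O(1/n) after
   normalisation. *)

theory Submission
  imports Defs
begin

section \<open>Residues modulo \<open>n\<close> and neighbourhoods\<close>

lemma wrap_in_vertices: "0 < n \<Longrightarrow> wrap n x \<in> vertices n"
  using pos_mod_bound [of "int n" "x - 1"] pos_mod_sign [of "int n" "x - 1"]
  unfolding wrap_def vertices_def atLeastAtMost_iff by linarith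

lemma wrap_vertex: "x \<in> vertices n \<Longrightarrow> wrap n x = x"
  by (simp add: wrap_def vertices_def)

lemma wrap_eq_iff: "wrap n x = wrap n y \<longleftrightarrow> int n dvd x - y"
  by (simp add: wrap_def mod_eq_dvd_iff)

lemma wrap_wrap_add: "wrap n (wrap n x + y) = wrap n (x + y)"
proof -
  have "((x - 1) mod int n + y) mod int n = (x - 1 + y) mod int n"
    by (rule mod_add_left_eq)
  moreover have "wrap n x + y - 1 = (x - 1) mod int n + y" "x + y - 1 = x - 1 + y"
    by (simp_all add: wrap_def)
  ultimately show ?thesis
    unfolding wrap_def [of n "wrap n x + y"] wrap_def [of n "x + y"] by presburger
qed

lemma wrap_eqD:
  assumes "wrap n x = wrap n y" "\<bar>x - y\<bar> < int n"
  shows "x = y"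
  using assms zdvd_not_zless [of "\<bar>x - y\<bar>" "int n"] by (auto simp: wrap_eq_iff)

lemma finite_vertices [simp]: "finite (vertices n)"
  by (simp add: vertices_def)

lemma card_vertices [simp]: "card (vertices n) = n"
  by (simp add: vertices_def)

lemma finite_nbrs [simp]: "finite (nbrs n X v)"
  by (simp add: nbrs_def)

lemma finite_candidates [simp]: "finite (candidates n k G i)"
  by (simp add: candidates_def)

lemma nbrs_mono: "X \<subseteq> Y \<Longrightarrow> nbrs n X v \<subseteq> nbrs n Y v"
  by (auto simp: nbrs_def)

lemma card_nbrs_mono: "X \<subseteq> Y \<Longrightarrow> card (nbrs n X v) \<le> card (nbrs n Y v)"
  by (intro card_mono nbrs_mono) auto

lemma card_nbrs_le: "card (nbrs n X v) \<le> n"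
  using card_mono [of "vertices n" "nbrs n X v"] by (auto simp: nbrs_def)

lemma finite_set_pmf_rewire_step: "finite (set_pmf (rewire_step n k p i d G))"
  by (auto simp: rewire_step_def set_pmf_of_set)

lemma real_card_filter: "finite A \<Longrightarrow> real (card {x \<in> A. P x}) = (\<Sum>x\<in>A. of_bool (P x))"
  by (simp add: sum_of_bool_eq Collect_conj_eq)

section \<open>The trace of the cube as a count of closed walks\<close>

lemma sum_vertices: "(\<Sum>a\<in>vertices n. f a) = (\<Sum>i<n. f (int i + 1))"
  by (rule sum.reindex_bij_witness [of _ "\<lambda>i. int i + 1" "\<lambda>a. nat (a - 1)"])
    (auto simp: vertices_def)

lemma trace_adjacency_cube:
  "mat_trace (adjacency_matrix n G ^\<^sub>m 3) = real (card
    {(a, b, c) \<in> vertices n \<times> vertices n \<times> vertices n. {a, b} \<in> G \<and> {b, c} \<in> G \<and> {c, a} \<in> G})"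
proof -
  let ?V = "vertices n"
  define A where "A = adjacency_matrix n G"
  have A: "A \<in> carrier_mat n n" by (simp add: A_def adjacency_matrix_def)
  have "A ^\<^sub>m 3 = A * (A * A)"
    using A by (simp add: numeral_3_eq_3)
  then have "mat_trace (A ^\<^sub>m 3)
      = (\<Sum>i<n. \<Sum>j<n. A $$ (i, j) * (\<Sum>l<n. A $$ (j, l) * A $$ (l, i)))"
    using A by (simp add: mat_trace_def scalar_prod_def atLeast0LessThan)
  also have "\<dots> = (\<Sum>i<n. \<Sum>j<n. \<Sum>l<n. of_bool ({int i + 1, int j + 1} \<in> G \<and>
      {int j + 1, int l + 1} \<in> G \<and> {int l + 1, int i + 1} \<in> G))"
    unfolding sum_distrib_left by (intro sum.cong refl) (auto simp: A_def adjacency_matrix_def)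
  also have "\<dots> = (\<Sum>a\<in>?V. \<Sum>b\<in>?V. \<Sum>c\<in>?V. of_bool ({a, b} \<in> G \<and> {b, c} \<in> G \<and> {c, a} \<in> G))"
    by (simp add: sum_vertices)
  also have "\<dots> = (\<Sum>t\<in>?V \<times> ?V \<times> ?V.
      of_bool (case t of (a, b, c) \<Rightarrow> {a, b} \<in> G \<and> {b, c} \<in> G \<and> {c, a} \<in> G))"
    unfolding sum.cartesian_product by (rule sum.cong) auto
  also have "\<dots> = real (card {t \<in> ?V \<times> ?V \<times> ?V.
      case t of (a, b, c) \<Rightarrow> {a, b} \<in> G \<and> {b, c} \<in> G \<and> {c, a} \<in> G})"
    by (rule real_card_filter [symmetric]) simp
  also have "{t \<in> ?V \<times> ?V \<times> ?V. case t of (a, b, c) \<Rightarrow> {a, b} \<in> G \<and> {b, c} \<in> G \<and> {c, a} \<in> G}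
      = {(a, b, c) \<in> ?V \<times> ?V \<times> ?V. {a, b} \<in> G \<and> {b, c} \<in> G \<and> {c, a} \<in> G}"
    by auto
  finally show ?thesis by (simp only: A_def)
qed

text \<open>\<open>n_large\<close> makes "\<open>n\<close> much larger than \<open>k\<close>"
  precise. Three lattice steps cover a distance of at most \<open>3 * m\<close>, so below
  \<open>n\<close> no triangle can wind around the ring.\<close>

locale small_world_process =
  fixes n k :: nat and p :: real
  assumes p01: "0 \<le> p" "p \<le> 1" and n_large: "3 * (k div 2) < n"
begin

abbreviation "m \<equiv> k div 2"
abbreviation "V \<equiv> vertices n"
abbreviation "L \<equiv> ring_lattice n k"
abbreviation "deg X v \<equiv> real (card (nbrs n X v))"

definition offsets :: "int set" where
  "offsets = {- int m..int m} - {0}"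

definition valid :: "int \<times> int \<Rightarrow> bool" where
  "valid s \<longleftrightarrow> fst s \<in> V \<and> snd s \<in> {1..int m}"

definition edge :: "int \<times> int \<Rightarrow> int set" where
  "edge s = {fst s, wrap n (fst s + snd s)}"

definition process :: "(int \<times> int) list \<Rightarrow> int set set pmf" where
  "process xs = fold (\<lambda>(i, d) M. bind_pmf M (rewire_step n k p i d)) xs (return_pmf L)"

definition expect :: "(int \<times> int) list \<Rightarrow> (int set set \<Rightarrow> real) \<Rightarrow> real" where
  "expect xs h = measure_pmf.expectation (process xs) h"

definition step_expect :: "int \<times> int \<Rightarrow> int set set \<Rightarrow> (int set set \<Rightarrow> real) \<Rightarrow> real" where
  "step_expect s G h = measure_pmf.expectation (rewire_step n k p (fst s) (snd s) G) h"

definition rewired :: "int set set \<Rightarrow> int \<times> int \<Rightarrow> int \<Rightarrow> int set set" where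
  "rewired G s j = insert {fst s, j} (G - {edge s})"

section \<open>Geometry of the ring lattice\<close>

lemma n_pos: "0 < n"
  using n_large by simp

lemma wrap_in [simp]: "wrap n x \<in> V"
  using n_pos by (rule wrap_in_vertices)

text \<open>The ring lattice is defined by forward steps only. Reading an edge from its other end
  negates the step, so signed offsets give a criterion that treats both endpoints alike.\<close>

lemma lattice_edge_iff:
  assumes "u \<in> V" "v \<in> V"
  shows "{u, v} \<in> L \<longleftrightarrow> (\<exists>x\<in>offsets. v = wrap n (u + x))"
proof
  assume "{u, v} \<in> L"
  then obtain i d where *: "{u, v} = {i, wrap n (i + d)}" "i \<in> V" "d \<in> {1..int m}"
    unfolding ring_lattice_def by blast
  then consider "u = i" "v = wrap n (i + d)" | "v = i" "u = wrap n (i + d)"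
    by (auto simp: doubleton_eq_iff)
  then show "\<exists>x\<in>offsets. v = wrap n (u + x)"
  proof cases
    case 1
    with * show ?thesis by (intro bexI [of _ d]) (auto simp: offsets_def)
  next
    case 2
    then have "v = wrap n (u + - d)"
      using wrap_wrap_add [of n "i + d" "- d"] \<open>i \<in> V\<close> by (simp add: wrap_vertex)
    with * show ?thesis by (intro bexI [of _ "- d"]) (auto simp: offsets_def)
  qed
next
  assume "\<exists>x\<in>offsets. v = wrap n (u + x)"
  then obtain x where x: "x \<in> offsets" "v = wrap n (u + x)" by blast
  show "{u, v} \<in> L"
  proof (cases "0 < x")
    case True
    then have "x \<in> {1..int m}"
      using x(1) by (auto simp: offsets_def)
    then have "{u, wrap n (u + x)} \<in> L"
      using assms(1) unfolding ring_lattice_def by blast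
    then show ?thesis by (simp add: x)
  next
    case False
    have "u = wrap n (v + - x)"
      using wrap_wrap_add [of n "u + x" "- x"] assms by (simp add: x wrap_vertex)
    moreover have "- x \<in> {1..int m}"
      using False x(1) by (auto simp: offsets_def)
    then have "{v, wrap n (v + - x)} \<in> L"
      using assms(2) unfolding ring_lattice_def by blast
    ultimately show ?thesis by (metis insert_commute)
  qed
qed

lemma lattice_edge_subset: "e \<in> L \<Longrightarrow> e \<subseteq> V"
  by (auto simp: ring_lattice_def)

lemma offset_ne:
  assumes "u \<in> V" "x \<in> offsets"
  shows "wrap n (u + x) \<noteq> u"
proof
  assume "wrap n (u + x) = u"
  moreover have "\<bar>u + x - u\<bar> < int n"
    using assms n_large by (auto simp: offsets_def)
  ultimately have "u + x = u"
    using assms(1) wrap_eqD [of n "u + x" u] wrap_vertex [of u n] by metis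
  with assms show False by (simp add: offsets_def)
qed

lemma lattice_loopfree: "{v} \<notin> L"
proof
  assume *: "{v} \<in> L"
  then have "v \<in> V" using lattice_edge_subset by blast
  then obtain x where "x \<in> offsets" "v = wrap n (v + x)"
    using * lattice_edge_iff [of v v] by auto
  with \<open>v \<in> V\<close> offset_ne show False by metis
qed

lemma not_window_not_lattice:
  assumes "i \<in> V" "j \<in> V" "j \<notin> lattice_window n k i"
  shows "{i, j} \<notin> L"
  using assms by (auto simp: lattice_edge_iff lattice_window_def offsets_def)

lemma card_lattice_window_le: "card (lattice_window n k i) \<le> 2 * m + 1"
  unfolding lattice_window_def
  by (rule order_trans [OF card_image_le]) auto

lemma in_lattice_window: "i \<in> V \<Longrightarrow> i \<in> lattice_window n k i"
  unfolding lattice_window_def by (rule image_eqI [of _ _ 0]) (auto simp: wrap_vertex)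

lemma edge_in_lattice: "valid s \<Longrightarrow> edge s \<in> L"
  by (force simp: valid_def edge_def ring_lattice_def)

text \<open>No lattice edge is treated twice. Were an edge listed from both of its ends, the two
  forward steps would add up to a multiple of \<open>n\<close>, yet \<open>0 < d + d'\<close> and
  \<open>d + d' \<le> 2 * m < n\<close>.\<close>

lemma inj_on_edge: "inj_on edge {s. valid s}"
proof (rule inj_onI)
  fix s t assume *: "s \<in> {s. valid s}" "t \<in> {s. valid s}" "edge s = edge t"
  obtain i d i' d' where [simp]: "s = (i, d)" "t = (i', d')" by (cases s, cases t)
  have v: "i \<in> V" "i' \<in> V" "1 \<le> d" "d \<le> int m" "1 \<le> d'" "d' \<le> int m"
    using * by (auto simp: valid_def)
  from * consider "i = i'" "wrap n (i + d) = wrap n (i' + d')"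
    | "i = wrap n (i' + d')" "i' = wrap n (i + d)"
    by (auto simp: edge_def doubleton_eq_iff)
  then show "s = t"
  proof cases
    case 1
    with v n_large wrap_eqD [of n "i + d" "i' + d'"] show ?thesis by auto
  next
    case 2
    then have "wrap n (i + (d + d')) = wrap n i"
      using v by (metis add.assoc wrap_wrap_add wrap_vertex)
    with v n_large wrap_eqD [of n "i + (d + d')" i] show ?thesis by auto
  qed
qed

lemma lattice_eq_edges: "L = edge ` {s. valid s}"
  by (auto simp: ring_lattice_def edge_def valid_def image_def)

section \<open>Expectations along the rewiring process\<close>

lemma process_Nil: "process [] = return_pmf L"
  by (simp add: process_def)

lemma process_snoc:
  "process (xs @ [s]) = bind_pmf (process xs) (rewire_step n k p (fst s) (snd s))"
  by (simp add: process_def split: prod.split)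

lemma finite_set_pmf_process [simp]: "finite (set_pmf (process xs))"
  by (induction xs rule: rev_induct)
    (auto simp: process_Nil process_snoc finite_set_pmf_rewire_step)

lemma integrable_process [simp]: "integrable (measure_pmf (process xs)) (h :: _ \<Rightarrow> real)"
  by (rule integrable_measure_pmf_finite) simp

lemma expect_Nil: "expect [] h = h L"
  by (simp add: expect_def process_Nil)

text \<open>The tower property, conditioning on the graph before the last step. It drives the
  inductions over the list of steps, which therefore peel off the last step.\<close>

lemma expect_snoc: "expect (xs @ [s]) h = expect xs (\<lambda>G. step_expect s G h)"
proof -
  have "expect (xs @ [s]) h = (\<Sum>G\<in>set_pmf (process xs). pmf (process xs) G *\<^sub>R step_expect s G h)"
    unfolding expect_def process_snoc step_expect_def
    by (rule pmf_expectation_bind) (auto simp: finite_set_pmf_rewire_step)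
  also have "\<dots> = expect xs (\<lambda>G. step_expect s G h)"
    unfolding expect_def by (rule integral_measure_pmf [symmetric]) auto
  finally show ?thesis .
qed

lemma expect_mono: "(\<And>G. G \<in> set_pmf (process xs) \<Longrightarrow> f G \<le> g G) \<Longrightarrow> expect xs f \<le> expect xs g"
  unfolding expect_def by (intro integral_mono_AE) (auto simp: AE_measure_pmf_iff)

lemma expect_cong: "(\<And>G. G \<in> set_pmf (process xs) \<Longrightarrow> f G = g G) \<Longrightarrow> expect xs f = expect xs g"
  by (intro antisym expect_mono) auto

lemma expect_add: "expect xs (\<lambda>G. f G + g G) = expect xs f + expect xs g"
  by (simp add: expect_def)

lemma expect_cmult: "expect xs (\<lambda>G. c * f G) = c * expect xs f"
  by (simp add: expect_def)

lemma expect_const: "expect xs (\<lambda>G. c) = c"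
  by (simp add: expect_def)

lemma expect_sum: "expect xs (\<lambda>G. \<Sum>i\<in>A. f i G) = (\<Sum>i\<in>A. expect xs (f i))"
  by (simp add: expect_def)

text \<open>All later estimates of a single step start from this formula. The case
  \<open>C = {}\<close> reflects the convention that an edge without a possible new endpoint is
  kept.\<close>

lemma step_expect_eq:
  "step_expect s G h =
    (let C = candidates n k G (fst s) in
     if C = {} then h G
     else (1 - p) * h G + p * ((\<Sum>j\<in>C. h (rewired G s j)) / real (card C)))"
proof -
  let ?C = "candidates n k G (fst s)"
  define K where "K = (\<lambda>rewire. if rewire \<and> ?C \<noteq> {} then map_pmf (rewired G s) (pmf_of_set ?C)
    else return_pmf G)"
  have K: "rewire_step n k p (fst s) (snd s) G = bind_pmf (bernoulli_pmf p) K"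
    unfolding rewire_step_def K_def rewired_def [abs_def] edge_def by (rule refl)
  have fin: "finite (set_pmf (K b))" for b
    by (auto simp: K_def set_pmf_of_set)
  have "step_expect s G h
      = (\<Sum>b\<in>UNIV. pmf (bernoulli_pmf p) b *\<^sub>R measure_pmf.expectation (K b) h)"
    unfolding step_expect_def K by (rule pmf_expectation_bind) (auto simp: fin)
  also have "\<dots> = p * measure_pmf.expectation (K True) h + (1 - p) * h G"
    using p01 by (simp add: UNIV_bool K_def)
  finally show ?thesis
    by (auto simp: K_def integral_pmf_of_set algebra_simps Let_def)
qed

text \<open>The only edge a step can delete belongs to \<open>L\<close>, and the union puts it
  back.\<close>

lemma rewired_Un_lattice:
  "valid s \<Longrightarrow> rewired G s j \<union> L = insert {fst s, j} (G \<union> L)"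
  using edge_in_lattice [of s] by (auto simp: rewired_def)

section \<open>Availability of new endpoints\<close>

definition blocked :: "int set set \<Rightarrow> int \<Rightarrow> real" where
  "blocked X i = 2 * real m + 1 + deg X i"

lemma blocked_mono: "X \<subseteq> Y \<Longrightarrow> blocked X i \<le> blocked Y i"
  by (simp add: blocked_def card_nbrs_mono)

lemma blocked_nonneg: "0 \<le> blocked X i"
  by (simp add: blocked_def)

text \<open>A vertex is excluded by the window, of size at most \<open>2 * m + 1\<close>, or as a
  current neighbour. Measuring the degree in \<open>G \<union> L\<close> instead of \<open>G\<close>
  weakens the bound but makes it monotone along the process.\<close>

lemma card_candidates_ge: "real n \<le> real (card (candidates n k G i)) + blocked (G \<union> L) i"
proof -
  have "card V - card (lattice_window n k i \<union> nbrs n G i) \<le> card (candidates n k G i)"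
    unfolding candidates_def by (rule diff_card_le_card_Diff) (auto simp: lattice_window_def)
  moreover have "card (lattice_window n k i \<union> nbrs n G i) \<le> (2 * m + 1) + card (nbrs n (G \<union> L) i)"
    by (intro order_trans [OF card_Un_le] add_mono card_lattice_window_le card_nbrs_mono) auto
  ultimately have "n \<le> card (candidates n k G i) + ((2 * m + 1) + card (nbrs n (G \<union> L) i))"
    by simp
  then show ?thesis unfolding blocked_def by linarith
qed

text \<open>The two summands serve two cases. With at least \<open>n / 2\<close> candidates, the
  average over \<open>C\<close> is at most twice the average over \<open>V\<close>. With fewer, the
  crude bound \<open>M\<close> is used, and \<open>blocked\<close> exceeds \<open>n / 2\<close>, so
  its factor \<open>2 * blocked (G \<union> L) i / real n\<close> is at least 1. Adding both removes
  the case distinction from what follows.\<close>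

lemma candidates_average_le:
  assumes f: "\<And>j. j \<in> V \<Longrightarrow> 0 \<le> f j \<and> f j \<le> M"
    and C: "C = candidates n k G i" "C \<noteq> {}"
  shows "(\<Sum>j\<in>C. f j) / real (card C) \<le> 2 / real n * (\<Sum>j\<in>V. f j) + 2 * M * blocked (G \<union> L) i / real n"
    (is "_ \<le> ?A + ?B")
proof -
  have sub: "C \<subseteq> V" and fin: "finite C" using C by (auto simp: candidates_def)
  have c: "0 < real (card C)" using C fin by (simp add: card_gt_0_iff)
  obtain j where "j \<in> C" using C by blast
  then have M: "0 \<le> M" using f sub by force
  have A: "0 \<le> ?A" using f by (intro mult_nonneg_nonneg sum_nonneg) auto
  have B: "0 \<le> ?B" using M blocked_nonneg by simp
  show ?thesis
  proof (cases "real n \<le> 2 * real (card C)")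
    case True
    have "(\<Sum>j\<in>C. f j) / real (card C) \<le> (\<Sum>j\<in>V. f j) / (real n / 2)"
      using True f sub n_pos by (intro frac_le sum_mono2 sum_nonneg) auto
    then have "(\<Sum>j\<in>C. f j) / real (card C) \<le> ?A" by (simp add: mult.commute)
    then show ?thesis using B by linarith
  next
    case False
    have "(\<Sum>j\<in>C. f j) \<le> real (card C) * M"
      using sum_bounded_above [of C f M] f sub by auto
    then have "(\<Sum>j\<in>C. f j) / real (card C) \<le> M"
      using c by (simp add: divide_le_eq mult.commute)
    also have "\<dots> = M * 1" by simp
    also have "M * 1 \<le> M * (2 * blocked (G \<union> L) i / real n)"
    proof (rule mult_left_mono [OF _ M])
      have "real n \<le> 2 * blocked (G \<union> L) i"
        using False card_candidates_ge [of G i] by (simp add: C)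
      then show "1 \<le> 2 * blocked (G \<union> L) i / real n"
        using n_pos by simp
    qed
    also have "M * (2 * blocked (G \<union> L) i / real n) = ?B" by simp
    finally show ?thesis using A by simp
  qed
qed

subsection \<open>Potential functions\<close>

lemma step_expect_mono:
  assumes "h G \<le> g G"
    and "\<And>j. j \<in> candidates n k G (fst s) \<Longrightarrow> h (rewired G s j) \<le> g (rewired G s j)"
  shows "step_expect s G h \<le> step_expect s G g"
  unfolding step_expect_eq Let_def using assms p01
  by (auto intro!: add_mono mult_left_mono divide_right_mono sum_mono)

lemma step_expect_const: "step_expect s G (\<lambda>_. c) = c"
  by (simp add: step_expect_def)

lemma step_expect_increasing:
  assumes "valid s" and h: "\<And>X Y. X \<subseteq> Y \<Longrightarrow> h X \<le> h Y"
  shows "h (G \<union> L) \<le> step_expect s G (\<lambda>G. h (G \<union> L))"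
proof -
  have "step_expect s G (\<lambda>_. h (G \<union> L)) \<le> step_expect s G (\<lambda>G. h (G \<union> L))"
    by (intro step_expect_mono) (auto simp: rewired_Un_lattice assms(1) intro!: h)
  then show ?thesis by (simp add: step_expect_const)
qed

text \<open>For monotone \<open>h\<close>, the values on \<open>G \<union> L\<close> form a
  submartingale, since this graph never loses an edge. Quantities met at an intermediate time can
  thus be estimated at the end of the process.\<close>

lemma expect_increasing:
  assumes "\<forall>s\<in>set ys. valid s" and h: "\<And>X Y. X \<subseteq> Y \<Longrightarrow> h X \<le> h Y"
  shows "expect xs (\<lambda>G. h (G \<union> L)) \<le> expect (xs @ ys) (\<lambda>G. h (G \<union> L))"
  using assms(1)
proof (induction ys rule: rev_induct)
  case (snoc s ys)
  have "expect (xs @ ys) (\<lambda>G. h (G \<union> L))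
      \<le> expect (xs @ ys) (\<lambda>G. step_expect s G (\<lambda>G. h (G \<union> L)))"
    using snoc.prems by (intro expect_mono step_expect_increasing h) auto
  with snoc show ?case
    by (simp flip: append_assoc add: expect_snoc)
qed simp

text \<open>The one-step drift of a potential: \<open>f j\<close> bounds the growth caused by the
  new edge to \<open>j\<close>, and \<open>candidates_average_le\<close> averages it over the
  candidates. A loop cannot arise, as \<open>i\<close> lies in its own window.\<close>

lemma step_drift:
  assumes s: "valid s" and i: "i = fst s"
    and f: "\<And>j. j \<in> V \<Longrightarrow> 0 \<le> f j \<and> f j \<le> M"
    and h: "\<And>j. j \<in> V \<Longrightarrow> j \<noteq> i \<Longrightarrow> h (insert {i, j} (G \<union> L)) \<le> h (G \<union> L) + f j"
  shows "step_expect s G (\<lambda>G. h (G \<union> L))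
    \<le> h (G \<union> L) + (2 / real n * (\<Sum>j\<in>V. f j) + 2 * M * blocked (G \<union> L) i / real n)"
    (is "?l \<le> ?h + ?R")
proof -
  have iV: "i \<in> V" using s i by (auto simp: valid_def)
  define C where "C = candidates n k G i"
  have M: "0 \<le> M" using f [OF iV] by linarith
  have R: "0 \<le> ?R"
    using f M blocked_nonneg by (intro add_nonneg_nonneg mult_nonneg_nonneg sum_nonneg divide_nonneg_nonneg) auto
  show ?thesis
  proof (cases "C = {}")
    case True
    then show ?thesis using R by (simp add: step_expect_eq C_def i)
  next
    case False
    then have c: "0 < real (card C)" by (simp add: C_def card_gt_0_iff)
    have "(\<Sum>j\<in>C. h (rewired G s j \<union> L)) \<le> (\<Sum>j\<in>C. ?h + f j)"
    proof (rule sum_mono)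
      fix j assume "j \<in> C"
      then have "j \<in> V" "j \<noteq> i"
        using in_lattice_window [OF iV] by (auto simp: C_def candidates_def)
      then show "h (rewired G s j \<union> L) \<le> ?h + f j"
        using h i s by (simp add: rewired_Un_lattice)
    qed
    also have "\<dots> = real (card C) * ?h + (\<Sum>j\<in>C. f j)"
      by (simp add: sum.distrib)
    finally have "(\<Sum>j\<in>C. h (rewired G s j \<union> L)) / real (card C) \<le> ?h + (\<Sum>j\<in>C. f j) / real (card C)"
      using c by (simp add: field_simps)
    also have "\<dots> \<le> ?h + ?R"
      using candidates_average_le [OF f C_def False] by simp
    \<comment> \<open>As \<open>?R\<close> is nonnegative, it may be added to the branch that keeps
      the edge as well; this eliminates \<open>p\<close> from the bound.\<close>
    finally have "(1 - p) * ?h + p * ((\<Sum>j\<in>C. h (rewired G s j \<union> L)) / real (card C))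
        \<le> (1 - p) * (?h + ?R) + p * (?h + ?R)"
      using p01 R by (intro add_mono mult_left_mono) auto
    also have "\<dots> = ?h + ?R" by (simp add: left_diff_distrib)
    finally show ?thesis
      using False by (simp add: step_expect_eq C_def i Let_def)
  qed
qed

text \<open>The drifts telescope. Every drift is then moved to the final time of
  \<open>xs @ ys\<close>, so that one law governs all summands. The list \<open>ys\<close> is
  arbitrary because the induction transfers the steps removed from \<open>xs\<close> to it.\<close>

lemma potential_bound_list:
  assumes step: "\<And>s G. valid s \<Longrightarrow>
      step_expect s G (\<lambda>G. h (G \<union> L)) \<le> h (G \<union> L) + r (G \<union> L) (fst s)"
    and r: "\<And>X Y i. X \<subseteq> Y \<Longrightarrow> r X i \<le> r Y i"
    and "\<forall>s\<in>set (xs @ ys). valid s"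
  shows "expect xs (\<lambda>G. h (G \<union> L))
    \<le> h L + (\<Sum>s\<leftarrow>xs. expect (xs @ ys) (\<lambda>G. r (G \<union> L) (fst s)))"
  using assms(3)
proof (induction xs arbitrary: ys rule: rev_induct)
  case Nil
  then show ?case by (simp add: expect_Nil)
next
  case (snoc s xs)
  have "expect (xs @ [s]) (\<lambda>G. h (G \<union> L)) \<le> expect xs (\<lambda>G. h (G \<union> L) + r (G \<union> L) (fst s))"
    unfolding expect_snoc using snoc.prems by (intro expect_mono step) auto
  also have "\<dots> = expect xs (\<lambda>G. h (G \<union> L)) + expect xs (\<lambda>G. r (G \<union> L) (fst s))"
    by (rule expect_add)
  also have "expect xs (\<lambda>G. h (G \<union> L))
      \<le> h L + (\<Sum>t\<leftarrow>xs. expect (xs @ s # ys) (\<lambda>G. r (G \<union> L) (fst t)))"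
    using snoc.IH [of "s # ys"] snoc.prems by simp
  also have "expect xs (\<lambda>G. r (G \<union> L) (fst s)) \<le> expect (xs @ s # ys) (\<lambda>G. r (G \<union> L) (fst s))"
    using snoc.prems by (intro expect_increasing [where h = "\<lambda>X. r X (fst s)"] r) auto
  finally show ?case by simp
qed

section \<open>The complete schedule\<close>

definition schedule :: "(int \<times> int) list" where
  "schedule = List.product [1..int n] [1..int m]"

lemma set_schedule: "set schedule = {s. valid s}"
  by (auto simp: schedule_def valid_def vertices_def)

lemma distinct_schedule: "distinct schedule"
  by (simp add: schedule_def distinct_product)

lemma small_world_eq: "small_world n k p = process schedule"
  by (simp add: small_world_def process_def schedule_def)

lemma valid_eq: "{s. valid s} = V \<times> {1..int m}"
  by (auto simp: valid_def)

lemma sum_schedule: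
  fixes g :: "int \<Rightarrow> real"
  shows "(\<Sum>s\<leftarrow>schedule. g (fst s)) = real m * (\<Sum>i\<in>V. g i)"
proof -
  have "(\<Sum>s\<leftarrow>schedule. g (fst s)) = (\<Sum>s\<in>V \<times> {1..int m}. g (fst s))"
    by (simp add: sum_list_distinct_conv_sum_set distinct_schedule set_schedule valid_eq)
  also have "\<dots> = (\<Sum>i\<in>V. \<Sum>d\<in>{1..int m}. g i)"
    unfolding sum.cartesian_product by (rule sum.cong) auto
  finally show ?thesis
    by (simp add: sum_distrib_left)
qed

text \<open>Rewiring removes lattice edges only, so \<open>G \<union> L\<close> is the set of all edges that were ever
  present; unlike \<open>G\<close>, it grows along the process.\<close>

definition union_expect :: "(int set set \<Rightarrow> real) \<Rightarrow> real" where
  "union_expect h = expect schedule (\<lambda>G. h (G \<union> L))"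

lemma union_expect_add: "union_expect (\<lambda>X. f X + g X) = union_expect f + union_expect g"
  by (simp add: union_expect_def expect_add)

lemma union_expect_cmult: "union_expect (\<lambda>X. c * f X) = c * union_expect f"
  by (simp add: union_expect_def expect_cmult)

lemma union_expect_const: "union_expect (\<lambda>X. c) = c"
  by (simp add: union_expect_def expect_const)

lemma union_expect_sum: "union_expect (\<lambda>X. \<Sum>i\<in>A. f i X) = (\<Sum>i\<in>A. union_expect (f i))"
  by (simp add: union_expect_def expect_sum)

text \<open>The drift depends on a step only through its vertex, and each vertex owns
  \<open>m\<close> steps; this is where the factor \<open>real m\<close> originates.\<close>

lemma potential_bound:
  assumes "\<And>s G. valid s \<Longrightarrow>
      step_expect s G (\<lambda>G. h (G \<union> L)) \<le> h (G \<union> L) + r (G \<union> L) (fst s)"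
    and "\<And>X Y i. X \<subseteq> Y \<Longrightarrow> r X i \<le> r Y i"
  shows "union_expect h \<le> h L + real m * union_expect (\<lambda>X. \<Sum>i\<in>V. r X i)"
proof -
  have "union_expect h \<le> h L + (\<Sum>s\<leftarrow>schedule. expect schedule (\<lambda>G. r (G \<union> L) (fst s)))"
    unfolding union_expect_def
    by (rule potential_bound_list [where h = h and r = r and xs = schedule and ys = "[]",
          unfolded append_Nil2, OF assms])
      (auto simp: set_schedule)
  also have "\<dots> = h L + real m * (\<Sum>i\<in>V. expect schedule (\<lambda>G. r (G \<union> L) i))"
    by (rule arg_cong [where f = "(+) (h L)"], rule sum_schedule)
  finally show ?thesis
    by (simp add: union_expect_def expect_sum)
qed

subsection \<open>Degrees\<close>

lemma deg_insert:
  assumes "i \<noteq> j"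
  shows "deg (insert {i, j} X) v \<le> deg X v + of_bool (v = i) + of_bool (v = j)"
proof -
  let ?A = "if v = i then {j} else {}" and ?B = "if v = j then {i} else {}"
  have "card (nbrs n (insert {i, j} X) v) \<le> card (nbrs n X v \<union> ?A \<union> ?B)"
    by (intro card_mono) (auto simp: nbrs_def doubleton_eq_iff)
  also have "\<dots> \<le> card (nbrs n X v) + card ?A + card ?B"
    by (intro order_trans [OF card_Un_le] add_right_mono card_Un_le)
  finally show ?thesis
    by (auto split: if_splits)
qed

lemma deg_le: "deg X v \<le> real n"
  using card_nbrs_le by simp

lemma deg_mono: "X \<subseteq> Y \<Longrightarrow> deg X v \<le> deg Y v"
  by (simp add: card_nbrs_mono)

lemma deg_lattice_le: "v \<in> V \<Longrightarrow> deg L v \<le> 2 * real m + 1"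
proof -
  assume "v \<in> V"
  then have "nbrs n L v \<subseteq> lattice_window n k v"
    using not_window_not_lattice by (auto simp: nbrs_def)
  then have "card (nbrs n L v) \<le> 2 * m + 1"
    by (intro order_trans [OF card_mono card_lattice_window_le]) (auto simp: lattice_window_def)
  then show ?thesis by linarith
qed

definition deg_sum :: "int set set \<Rightarrow> real" where
  "deg_sum X = (\<Sum>v\<in>V. deg X v)"

definition deg_sq_sum :: "int set set \<Rightarrow> real" where
  "deg_sq_sum X = (\<Sum>v\<in>V. (deg X v)\<^sup>2)"

lemma deg_sum_insert:
  assumes "i \<noteq> j" "i \<in> V" "j \<in> V"
  shows "deg_sum (insert {i, j} X) \<le> deg_sum X + 2"
proof -
  have "deg_sum (insert {i, j} X) \<le> (\<Sum>v\<in>V. deg X v + of_bool (v = i) + of_bool (v = j))"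
    unfolding deg_sum_def by (intro sum_mono deg_insert assms)
  also have "\<dots> = deg_sum X + 2"
    using assms by (simp add: sum.distrib deg_sum_def of_bool_def)
  finally show ?thesis .
qed

text \<open>Only the degrees of the two endpoints grow, each by at most 1, and
  \<open>(d + 1)\<^sup>2 - d\<^sup>2 = 2 * d + 1\<close>.\<close>

lemma deg_sq_sum_insert:
  assumes "i \<noteq> j" "i \<in> V" "j \<in> V"
  shows "deg_sq_sum (insert {i, j} X) \<le> deg_sq_sum X + (2 + 2 * deg X i + 2 * deg X j)"
proof -
  have "deg_sq_sum (insert {i, j} X) \<le>
      (\<Sum>v\<in>V. (deg X v)\<^sup>2 + (if v = i then 2 * deg X i + 1 else 0) + (if v = j then 2 * deg X j + 1 else 0))"
    unfolding deg_sq_sum_def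
  proof (rule sum_mono)
    fix v assume "v \<in> V"
    have "(deg (insert {i, j} X) v)\<^sup>2 \<le> (deg X v + of_bool (v = i) + of_bool (v = j))\<^sup>2"
      by (intro power_mono deg_insert assms) simp
    then show "(deg (insert {i, j} X) v)\<^sup>2 \<le>
        (deg X v)\<^sup>2 + (if v = i then 2 * deg X i + 1 else 0) + (if v = j then 2 * deg X j + 1 else 0)"
      using assms by (auto simp: power2_eq_square algebra_simps split: if_splits)
  qed
  also have "\<dots> = deg_sq_sum X + (2 + 2 * deg X i + 2 * deg X j)"
    using assms by (simp add: sum.distrib deg_sq_sum_def)
  finally show ?thesis .
qed

text \<open>Uniformity in \<open>n\<close>: the constants \<open>c\<^sub>1\<close>, \<open>c\<^sub>2\<close>, \<open>c\<^sub>3\<close> depend on \<open>k\<close> only, although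
  the locale fixes \<open>n\<close> and \<open>p\<close> as well.\<close>

definition "c\<^sub>1 = 2 * real m + 1 + real m * (8 * real m + 12)"
definition "c\<^sub>2 = (2 * real m + 1)\<^sup>2 + real m * (4 + 20 * c\<^sub>1 + 12 * (2 * real m + 1))"
definition "c\<^sub>3 = real m * (24 * c\<^sub>2 + 12 * (2 * real m + 1) * c\<^sub>1)"

lemma blocked_le: "blocked X i / real n \<le> 2 * real m + 2"
proof -
  have "1 \<le> real n" using n_pos by simp
  then have "(2 * real m + 1) * 1 \<le> (2 * real m + 1) * real n"
    by (intro mult_left_mono) auto
  then have "blocked X i \<le> (2 * real m + 2) * real n"
    using deg_le [of X i] unfolding blocked_def by (simp add: algebra_simps)
  then show ?thesis using n_pos by (simp add: divide_le_eq)
qed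

lemma union_expect_deg_sum: "union_expect deg_sum \<le> c\<^sub>1 * real n"
proof -
  have "union_expect deg_sum \<le> deg_sum L + real m * union_expect (\<lambda>X. \<Sum>i\<in>V. 8 * real m + 12)"
  proof (rule potential_bound)
    fix s G assume s: "valid s"
    have "step_expect s G (\<lambda>G. deg_sum (G \<union> L)) \<le> deg_sum (G \<union> L) +
        (2 / real n * (\<Sum>j\<in>V. 2) + 2 * 2 * blocked (G \<union> L) (fst s) / real n)"
      by (rule step_drift [OF s refl]) (use s in \<open>auto simp: valid_def intro!: deg_sum_insert\<close>)
    \<comment> \<open>The first summand is 4; the second is at most \<open>4 * (2 * m + 2)\<close>
      by \<open>blocked_le\<close>.\<close>
    also have "2 / real n * (\<Sum>j\<in>V. 2) + 2 * 2 * blocked (G \<union> L) (fst s) / real n \<le> 8 * real m + 12"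
      using blocked_le [of "G \<union> L" "fst s"] n_pos by simp
    finally show "step_expect s G (\<lambda>G. deg_sum (G \<union> L)) \<le> deg_sum (G \<union> L) + (8 * real m + 12)"
      by simp
  qed auto
  moreover have "deg_sum L \<le> real n * (2 * real m + 1)"
    unfolding deg_sum_def
    using sum_bounded_above [of V "deg L" "2 * real m + 1"] deg_lattice_le by simp
  ultimately have "union_expect deg_sum \<le> real n * (2 * real m + 1) + real m * (real n * (8 * real m + 12))"
    by (simp add: union_expect_const)
  also have "\<dots> = c\<^sub>1 * real n"
    unfolding c\<^sub>1_def by (simp add: distrib_left distrib_right mult_ac)
  finally show ?thesis .
qed

lemma union_expect_deg_sq_sum: "union_expect deg_sq_sum \<le> c\<^sub>2 * real n"
proof -
  \<comment> \<open>This is the drift for \<open>f j = 2 + 2 * deg X i + 2 * deg X j\<close>: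
    doubling its average over \<open>j\<close> gives the first three terms. The last one comes from
    the trivial maximum \<open>M = 2 + 4 * n\<close>, both degrees being at most
    \<open>n\<close>.\<close>
  let ?r = "\<lambda>X i. 4 + 4 * deg X i + 4 / real n * deg_sum X + 12 * blocked X i"
  have mono: "?r X i \<le> ?r Y i" if "X \<subseteq> Y" for X Y i
    using that unfolding deg_sum_def
    by (intro add_mono mult_left_mono blocked_mono deg_mono sum_mono order_refl) auto
  have "union_expect deg_sq_sum \<le> deg_sq_sum L + real m * union_expect (\<lambda>X. \<Sum>i\<in>V. ?r X i)"
  proof (rule potential_bound [OF _ mono])
    fix s G assume s: "valid s"
    let ?X = "G \<union> L" and ?i = "fst s"
    have "step_expect s G (\<lambda>G. deg_sq_sum (G \<union> L)) \<le> deg_sq_sum ?X +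
        (2 / real n * (\<Sum>j\<in>V. 2 + 2 * deg ?X ?i + 2 * deg ?X j)
          + 2 * (2 + 4 * real n) * blocked ?X ?i / real n)"
    proof (rule step_drift [OF s refl])
      fix j
      show "0 \<le> 2 + 2 * deg ?X ?i + 2 * deg ?X j \<and> 2 + 2 * deg ?X ?i + 2 * deg ?X j \<le> 2 + 4 * real n"
        using deg_le [of ?X ?i] deg_le [of ?X j] by simp
      assume "j \<in> V" "j \<noteq> ?i"
      then show "deg_sq_sum (insert {?i, j} ?X) \<le> deg_sq_sum ?X + (2 + 2 * deg ?X ?i + 2 * deg ?X j)"
        using s by (intro deg_sq_sum_insert) (auto simp: valid_def)
    qed
    also have "2 / real n * (\<Sum>j\<in>V. 2 + 2 * deg ?X ?i + 2 * deg ?X j)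
        = 4 + 4 * deg ?X ?i + 4 / real n * deg_sum ?X"
    proof -
      have "(\<Sum>j\<in>V. 2 + 2 * deg ?X ?i + 2 * deg ?X j) = real n * (2 + 2 * deg ?X ?i) + 2 * deg_sum ?X"
        by (simp add: sum.distrib deg_sum_def sum_distrib_left algebra_simps)
      then show ?thesis using n_pos by (simp add: field_simps)
    qed
    \<comment> \<open>Here \<open>n \<ge> 1\<close> turns \<open>4 + 8 * n\<close> into at most
      \<open>12 * n\<close>.\<close>
    also have "2 * (2 + 4 * real n) * blocked ?X ?i / real n \<le> 12 * blocked ?X ?i"
    proof -
      have "(2 * (2 + 4 * real n)) * blocked ?X ?i \<le> (12 * real n) * blocked ?X ?i"
        using n_pos by (intro mult_right_mono blocked_nonneg) auto
      then show ?thesis using n_pos by (simp add: divide_le_eq mult_ac)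
    qed
    finally show "step_expect s G (\<lambda>G. deg_sq_sum (G \<union> L)) \<le> deg_sq_sum ?X + ?r ?X ?i"
      by simp
  qed
  moreover have "deg_sq_sum L \<le> real n * (2 * real m + 1)\<^sup>2"
    unfolding deg_sq_sum_def
    using sum_bounded_above [of V "\<lambda>v. (deg L v)\<^sup>2" "(2 * real m + 1)\<^sup>2"] deg_lattice_le
    by (simp add: power_mono)
  moreover have "union_expect (\<lambda>X. \<Sum>i\<in>V. ?r X i)
      \<le> (4 + 12 * (2 * real m + 1)) * real n + 20 * (c\<^sub>1 * real n)"
  proof -
    have "union_expect (\<lambda>X. \<Sum>i\<in>V. ?r X i)
        = union_expect (\<lambda>X. (4 + 12 * (2 * real m + 1)) * real n + 20 * deg_sum X)"
    proof (rule arg_cong [where f = union_expect], rule ext)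
      fix X
      \<comment> \<open>The coefficient 16 collects \<open>4 * deg X i\<close> and the degree inside
        \<open>12 * blocked X i\<close>. Summing the averaged term over \<open>V\<close> contributes
        another \<open>4 * deg_sum X\<close>, whence the 20 below.\<close>
      have "(\<Sum>i\<in>V. ?r X i)
          = (\<Sum>i\<in>V. 4 + 4 / real n * deg_sum X + 12 * (2 * real m + 1)) + (\<Sum>i\<in>V. 16 * deg X i)"
        unfolding sum.distrib [symmetric] by (rule sum.cong) (auto simp: blocked_def)
      also have "(\<Sum>i\<in>V. 16 * deg X i) = 16 * deg_sum X"
        by (simp add: deg_sum_def sum_distrib_left)
      also have "(\<Sum>i\<in>V. 4 + 4 / real n * deg_sum X + 12 * (2 * real m + 1))
          = (4 + 12 * (2 * real m + 1)) * real n + 4 * deg_sum X"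
        using n_pos by (simp add: field_simps)
      finally show "(\<Sum>i\<in>V. ?r X i) = (4 + 12 * (2 * real m + 1)) * real n + 20 * deg_sum X"
        by simp
    qed
    also have "\<dots> = (4 + 12 * (2 * real m + 1)) * real n + 20 * union_expect deg_sum"
      by (simp add: union_expect_add union_expect_const union_expect_cmult)
    also have "\<dots> \<le> (4 + 12 * (2 * real m + 1)) * real n + 20 * (c\<^sub>1 * real n)"
      using union_expect_deg_sum by simp
    finally show ?thesis .
  qed
  ultimately have "union_expect deg_sq_sum \<le> real n * (2 * real m + 1)\<^sup>2
      + real m * ((4 + 12 * (2 * real m + 1)) * real n + 20 * (c\<^sub>1 * real n))"
    by (meson add_mono mult_left_mono of_nat_0_le_iff order_trans)
  also have "\<dots> = c\<^sub>2 * real n"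
    unfolding c\<^sub>2_def by (simp add: distrib_left distrib_right mult_ac)
  finally show ?thesis .
qed

subsection \<open>Triangles with a rewired edge\<close>

definition common :: "int set set \<Rightarrow> int \<Rightarrow> int \<Rightarrow> int set" where
  "common X i j = {v \<in> V. {i, v} \<in> X \<and> {v, j} \<in> X}"

text \<open>The triples are ordered, so a triangle counts six times, exactly as in the trace of the
  cube.\<close>

definition triangles :: "int set set \<Rightarrow> (int \<times> int \<times> int) set" where
  "triangles X = {(a, b, c). a \<in> V \<and> b \<in> V \<and> c \<in> V \<and> a \<noteq> b \<and> b \<noteq> c \<and> c \<noteq> a \<and>
    {a, b} \<in> X \<and> {b, c} \<in> X \<and> {c, a} \<in> X}"

definition new_triangles :: "int set set \<Rightarrow> real" where
  "new_triangles X = real (card (triangles X - triangles L))"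

lemma finite_triangles [simp]: "finite (triangles X)"
  by (rule finite_subset [of _ "V \<times> V \<times> V"]) (auto simp: triangles_def)

lemma triangles_mono: "X \<subseteq> Y \<Longrightarrow> triangles X \<subseteq> triangles Y"
  by (auto simp: triangles_def)

text \<open>A triangle that appears must have \<open>{i, j}\<close> as a side. The side can sit in
  three positions with two orientations, which gives the six images, and the remaining corner is a
  common neighbour of \<open>i\<close> and \<open>j\<close>.\<close>

lemma triangles_insert:
  fixes i j X
  assumes "i \<noteq> j"
  defines "C \<equiv> common X i j"
  shows "triangles (insert {i, j} X) \<subseteq> triangles X \<union>
    ((\<lambda>v. (i, j, v)) ` C \<union> (\<lambda>v. (j, i, v)) ` C \<union> (\<lambda>v. (i, v, j)) ` C \<union>
     (\<lambda>v. (j, v, i)) ` C \<union> (\<lambda>v. (v, i, j)) ` C \<union> (\<lambda>v. (v, j, i)) ` C)" (is "_ \<subseteq> _ \<union> ?S")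
proof (rule subsetI, rule UnCI)
  fix t
  assume t: "t \<in> triangles (insert {i, j} X)" and nS': "t \<notin> ?S"
  obtain a b c where abc: "t = (a, b, c)" by (cases t)
  have nS: "(a, b, c) \<notin> ?S" using nS' abc by simp
  from t have d: "a \<in> V" "b \<in> V" "c \<in> V" "a \<noteq> b" "b \<noteq> c" "c \<noteq> a"
    and e: "{a, b} = {i, j} \<or> {a, b} \<in> X" "{b, c} = {i, j} \<or> {b, c} \<in> X" "{c, a} = {i, j} \<or> {c, a} \<in> X"
    by (auto simp: triangles_def abc)
  \<comment> \<open>If one side is the inserted edge, the other two contain the third corner
    \<open>w\<close>, differ from \<open>{i, j}\<close> and so were present before. The three
    rotations of the triple are handled by this one fact.\<close>
  have third: "w \<in> C" if "{u, v} = {i, j}" "w \<in> V" "w \<noteq> u" "w \<noteq> v"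
      "{v, w} = {i, j} \<or> {v, w} \<in> X" "{w, u} = {i, j} \<or> {w, u} \<in> X" for u v w
  proof -
    have "{v, w} \<noteq> {i, j}" "{w, u} \<noteq> {i, j}"
      using that by (auto simp: doubleton_eq_iff)
    with that have "{v, w} \<in> X" "{w, u} \<in> X" by auto
    with that show ?thesis
      unfolding C_def common_def doubleton_eq_iff by (auto simp: insert_commute)
  qed
  have "{a, b} \<noteq> {i, j}"
  proof
    assume "{a, b} = {i, j}"
    moreover from this have "c \<in> C" using third [of a b c] d e by metis
    ultimately show False using nS by (auto simp: doubleton_eq_iff)
  qed
  moreover have "{b, c} \<noteq> {i, j}"
  proof
    assume "{b, c} = {i, j}"
    moreover from this have "a \<in> C" using third [of b c a] d e by metis
    ultimately show False using nS by (auto simp: doubleton_eq_iff)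
  qed
  moreover have "{c, a} \<noteq> {i, j}"
  proof
    assume "{c, a} = {i, j}"
    moreover from this have "b \<in> C" using third [of c a b] d e by metis
    ultimately show False using nS by (auto simp: doubleton_eq_iff)
  qed
  ultimately show "t \<in> triangles X"
    using d e by (auto simp: triangles_def abc)
qed

lemma finite_common [simp]: "finite (common X i j)"
  by (simp add: common_def)

lemma new_triangles_insert:
  assumes "i \<noteq> j"
  shows "new_triangles (insert {i, j} X) \<le> new_triangles X + 6 * real (card (common X i j))"
proof -
  let ?C = "common X i j"
  let ?S = "(\<lambda>v. (i, j, v)) ` ?C \<union> (\<lambda>v. (j, i, v)) ` ?C \<union> (\<lambda>v. (i, v, j)) ` ?C \<union>
     (\<lambda>v. (j, v, i)) ` ?C \<union> (\<lambda>v. (v, i, j)) ` ?C \<union> (\<lambda>v. (v, j, i)) ` ?C"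
  have "card (triangles (insert {i, j} X) - triangles L) \<le> card ((triangles X - triangles L) \<union> ?S)"
    using triangles_insert [OF assms, of X] by (intro card_mono) auto
  also have "\<dots> \<le> card (triangles X - triangles L) + card ?S"
    by (rule card_Un_le)
  also have "card ?S \<le> card ?C + card ?C + card ?C + card ?C + card ?C + card ?C"
    by (intro order_trans [OF card_Un_le] add_mono card_image_le) auto
  finally show ?thesis unfolding new_triangles_def by linarith
qed

text \<open>The number of walks of length two starting at \<open>i\<close>, grouped by their middle
  vertex.\<close>

definition two_walks :: "int set set \<Rightarrow> int \<Rightarrow> real" where
  "two_walks X i = (\<Sum>v\<in>V. of_bool ({i, v} \<in> X) * deg X v)"

lemma sum_common: "(\<Sum>j\<in>V. real (card (common X i j))) = two_walks X i"
proof -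
  have "(\<Sum>j\<in>V. real (card (common X i j)))
      = (\<Sum>j\<in>V. \<Sum>v\<in>V. of_bool ({i, v} \<in> X) * of_bool ({v, j} \<in> X))"
    unfolding common_def by (simp add: real_card_filter of_bool_conj)
  also have "\<dots> = (\<Sum>v\<in>V. \<Sum>j\<in>V. of_bool ({i, v} \<in> X) * of_bool ({v, j} \<in> X))"
    by (rule sum.swap)
  also have "\<dots> = two_walks X i"
    unfolding two_walks_def nbrs_def
    by (simp only: real_card_filter [OF finite_vertices] sum_distrib_left)
  finally show ?thesis .
qed

text \<open>A walk of length two is a middle vertex with an ordered pair of its neighbours. This is
  why second moments of degrees have to be controlled.\<close>

lemma sum_two_walks: "(\<Sum>i\<in>V. two_walks X i) = deg_sq_sum X"
proof -
  have "(\<Sum>i\<in>V. two_walks X i) = (\<Sum>v\<in>V. \<Sum>i\<in>V. of_bool ({i, v} \<in> X) * deg X v)"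
    unfolding two_walks_def by (rule sum.swap)
  also have "\<dots> = (\<Sum>v\<in>V. (\<Sum>i\<in>V. of_bool ({v, i} \<in> X)) * deg X v)"
    by (simp add: sum_distrib_right insert_commute)
  also have "\<dots> = deg_sq_sum X"
    by (simp add: deg_sq_sum_def nbrs_def real_card_filter power2_eq_square)
  finally show ?thesis .
qed

lemma two_walks_mono: "X \<subseteq> Y \<Longrightarrow> two_walks X i \<le> two_walks Y i"
  unfolding two_walks_def by (intro sum_mono mult_mono deg_mono) auto

lemma common_le_deg: "card (common X i j) \<le> card (nbrs n X i)"
  by (intro card_mono) (auto simp: common_def nbrs_def)

text \<open>The new edge to \<open>j\<close> creates at most \<open>6 * card (common X i j)\<close>
  ordered triangles. Averaged over \<open>j\<close> and summed over \<open>i\<close>, this is a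
  degree sum of second order divided by \<open>n\<close>. Both degree sums are \<open>O(n)\<close>
  in expectation, so a bounded number remains.\<close>

lemma union_expect_new_triangles: "union_expect new_triangles \<le> c\<^sub>3"
proof -
  let ?r = "\<lambda>X i. 12 / real n * two_walks X i + 12 / real n * (deg X i * blocked X i)"
  have mono: "?r X i \<le> ?r Y i" if "X \<subseteq> Y" for X Y i
    using that blocked_nonneg
    by (intro add_mono mult_left_mono mult_mono two_walks_mono blocked_mono deg_mono) auto
  have "union_expect new_triangles \<le> new_triangles L + real m * union_expect (\<lambda>X. \<Sum>i\<in>V. ?r X i)"
  proof (rule potential_bound [OF _ mono])
    fix s G assume s: "valid s"
    let ?X = "G \<union> L" and ?i = "fst s"
    \<comment> \<open>The maximum is \<open>M = 6 * deg ?X ?i\<close>, since common neighbours are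
      in particular neighbours of \<open>?i\<close>.\<close>
    have "step_expect s G (\<lambda>G. new_triangles (G \<union> L)) \<le> new_triangles ?X +
        (2 / real n * (\<Sum>j\<in>V. 6 * real (card (common ?X ?i j)))
          + 2 * (6 * deg ?X ?i) * blocked ?X ?i / real n)"
      by (rule step_drift [OF s refl])
        (use common_le_deg new_triangles_insert in \<open>auto simp del: of_nat_le_iff\<close>)
    also have "\<dots> = new_triangles ?X + ?r ?X ?i"
      by (simp add: sum_distrib_left [symmetric] sum_common)
    finally show "step_expect s G (\<lambda>G. new_triangles (G \<union> L)) \<le> new_triangles ?X + ?r ?X ?i" .
  qed
  also have "new_triangles L = 0" by (simp add: new_triangles_def)
  also have "(\<lambda>X. \<Sum>i\<in>V. ?r X i)
      = (\<lambda>X. 24 / real n * deg_sq_sum X + 12 / real n * (2 * real m + 1) * deg_sum X)"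
  proof
    fix X
    have "(\<Sum>i\<in>V. deg X i * blocked X i) = (2 * real m + 1) * deg_sum X + deg_sq_sum X"
      unfolding deg_sum_def deg_sq_sum_def sum_distrib_left sum.distrib [symmetric]
      by (rule sum.cong) (auto simp: blocked_def power2_eq_square algebra_simps)
    then show "(\<Sum>i\<in>V. ?r X i)
        = 24 / real n * deg_sq_sum X + 12 / real n * (2 * real m + 1) * deg_sum X"
      unfolding sum.distrib sum_distrib_left [symmetric] sum_two_walks
      using n_pos by (simp add: field_simps)
  qed
  also have "union_expect \<dots>
      = 24 / real n * union_expect deg_sq_sum + 12 / real n * (2 * real m + 1) * union_expect deg_sum"
    by (simp only: union_expect_add union_expect_cmult)
  finally have *: "union_expect new_triangles \<le> real m *
      (24 / real n * union_expect deg_sq_sum + 12 / real n * (2 * real m + 1) * union_expect deg_sum)"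
    by simp
  have "24 / real n * union_expect deg_sq_sum + 12 / real n * (2 * real m + 1) * union_expect deg_sum
      \<le> 24 / real n * (c\<^sub>2 * real n) + 12 / real n * (2 * real m + 1) * (c\<^sub>1 * real n)"
    by (intro add_mono mult_left_mono union_expect_deg_sq_sum union_expect_deg_sum) auto
  also have "\<dots> = 24 * c\<^sub>2 + 12 * (2 * real m + 1) * c\<^sub>1"
    using n_pos by simp
  finally show ?thesis
    unfolding c\<^sub>3_def using * by (meson mult_left_mono of_nat_0_le_iff order_trans)
qed

subsection \<open>Survival of lattice triangles\<close>

definition subset_prob :: "(int \<times> int) list \<Rightarrow> int set set \<Rightarrow> real" where
  "subset_prob xs F = expect xs (\<lambda>G. of_bool (F \<subseteq> G))"

text \<open>A new edge lies outside \<open>L\<close>, hence outside \<open>F\<close>, so a lost edge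
  of \<open>F\<close> is never restored. The set \<open>F\<close> is damaged only if the treated
  edge belongs to it and is really rewired.\<close>

lemma step_expect_subset:
  assumes s: "valid s" and F: "F \<subseteq> L"
  shows "step_expect s G (\<lambda>G. of_bool (F \<subseteq> G)) = of_bool (F \<subseteq> G) *
    (if edge s \<in> F \<and> candidates n k G (fst s) \<noteq> {} then 1 - p else 1)"
proof -
  define C where "C = candidates n k G (fst s)"
  have new: "{fst s, j} \<notin> L" if "j \<in> C" for j
    using that s by (intro not_window_not_lattice) (auto simp: C_def candidates_def valid_def)
  have "F \<subseteq> rewired G s j \<longleftrightarrow> edge s \<notin> F \<and> F \<subseteq> G" if "j \<in> C" for j
    using new [OF that] F edge_in_lattice [OF s] unfolding rewired_def by auto
  then have sum: "(\<Sum>j\<in>C. of_bool (F \<subseteq> rewired G s j)) = real (card C) * of_bool (edge s \<notin> F \<and> F \<subseteq> G)"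
    by simp
  show ?thesis
  proof (cases "C = {}")
    case False
    then have "real (card C) \<noteq> 0" by (simp add: C_def)
    with False show ?thesis
      by (simp add: step_expect_eq Let_def C_def [symmetric] sum)
  qed (simp add: step_expect_eq Let_def C_def [symmetric])
qed

text \<open>No error term appears in this direction: a lack of candidates only helps an edge to
  survive.\<close>

lemma subset_prob_ge:
  assumes "\<forall>s\<in>set xs. valid s" and F: "F \<subseteq> L"
  shows "(1 - p) ^ length (filter (\<lambda>s. edge s \<in> F) xs) \<le> subset_prob xs F"
  using assms(1)
proof (induction xs rule: rev_induct)
  case Nil
  then show ?case using F by (simp add: subset_prob_def expect_Nil)
next
  case (snoc s xs)
  let ?q = "if edge s \<in> F then 1 - p else 1"
  have "?q * subset_prob xs F = expect xs (\<lambda>G. ?q * of_bool (F \<subseteq> G))"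
    by (simp only: subset_prob_def expect_cmult)
  also have "\<dots> \<le> subset_prob (xs @ [s]) F"
    unfolding subset_prob_def expect_snoc using p01 snoc.prems F
    by (intro expect_mono) (auto simp: step_expect_subset)
  finally show ?case
    using snoc p01 by (auto intro: order_trans [OF mult_left_mono])
qed

text \<open>Without candidates the survival factor is 1 instead of \<open>1 - p\<close>. Each
  treatment of an edge of \<open>F\<close> therefore adds at most the probability of that event,
  estimated through \<open>blocked / n\<close> and moved to the final time.\<close>

lemma subset_prob_le:
  assumes "\<forall>s\<in>set (xs @ ys). valid s" and F: "F \<subseteq> L"
  shows "subset_prob xs F \<le> (1 - p) ^ length (filter (\<lambda>s. edge s \<in> F) xs) +
    (\<Sum>s\<leftarrow>filter (\<lambda>s. edge s \<in> F) xs. expect (xs @ ys) (\<lambda>G. blocked (G \<union> L) (fst s) / real n))"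
  using assms(1)
proof (induction xs arbitrary: ys rule: rev_induct)
  case Nil
  then show ?case using F by (simp add: subset_prob_def expect_Nil)
next
  case (snoc s xs)
  let ?P = "\<lambda>s. edge s \<in> F" and ?b = "\<lambda>i G. blocked (G \<union> L) i / real n"
  let ?R = "\<Sum>t\<leftarrow>filter ?P xs. expect (xs @ s # ys) (?b (fst t))"
  have IH: "subset_prob xs F \<le> (1 - p) ^ length (filter ?P xs) + ?R"
    using snoc.IH [of "s # ys"] snoc.prems by simp
  have R: "0 \<le> ?R"
    unfolding expect_def
    by (intro sum_list_nonneg) (auto intro!: integral_nonneg_AE simp: blocked_nonneg)
  show ?case
  proof (cases "edge s \<in> F")
    case False
    then have "subset_prob (xs @ [s]) F = subset_prob xs F"
      unfolding subset_prob_def expect_snoc using snoc.prems F by (simp add: step_expect_subset)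
    then show ?thesis using IH False by simp
  next
    case True
    have "subset_prob (xs @ [s]) F \<le> expect xs (\<lambda>G. (1 - p) * of_bool (F \<subseteq> G) + ?b (fst s) G)"
      unfolding subset_prob_def expect_snoc
    proof (rule expect_mono)
      fix G
      \<comment> \<open>With no candidates, \<open>card_candidates_ge\<close> reads
        \<open>n \<le> blocked (G \<union> L) (fst s)\<close>.\<close>
      have b: "1 \<le> ?b (fst s) G" if "candidates n k G (fst s) = {}"
        using card_candidates_ge [of G "fst s"] that n_pos by simp
      have b0: "0 \<le> ?b (fst s) G" using blocked_nonneg by simp
      show "step_expect s G (\<lambda>G. of_bool (F \<subseteq> G)) \<le> (1 - p) * of_bool (F \<subseteq> G) + ?b (fst s) G"
        using snoc.prems F b b0 p01 True by (auto simp: step_expect_subset)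
    qed
    also have "\<dots> = (1 - p) * subset_prob xs F + expect xs (?b (fst s))"
      by (simp only: subset_prob_def expect_add expect_cmult)
    also have "(1 - p) * subset_prob xs F \<le> (1 - p) * ((1 - p) ^ length (filter ?P xs) + ?R)"
      using IH p01 by (intro mult_left_mono) auto
    also have "\<dots> \<le> (1 - p) ^ Suc (length (filter ?P xs)) + ?R"
      using R p01 by (simp add: distrib_left mult_left_le_one_le)
    also have "expect xs (?b (fst s)) \<le> expect (xs @ s # ys) (?b (fst s))"
      using snoc.prems
      by (intro expect_increasing [where h = "\<lambda>X. blocked X (fst s) / real n"] divide_right_mono blocked_mono) auto
    finally show ?thesis using True by simp
  qed
qed

text \<open>The schedule treats every lattice edge exactly once, so the exponent of
  \<open>1 - p\<close> is the number of edges in \<open>F\<close>.\<close>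

lemma length_filter_edges:
  assumes "F \<subseteq> L"
  shows "length (filter (\<lambda>s. edge s \<in> F) schedule) = card F"
proof -
  have "length (filter (\<lambda>s. edge s \<in> F) schedule) = card {s. valid s \<and> edge s \<in> F}"
    by (simp add: distinct_length_filter distinct_schedule set_schedule Collect_conj_eq Int_commute)
  also have "\<dots> = card (edge ` {s. valid s \<and> edge s \<in> F})"
    by (intro card_image [symmetric] inj_on_subset [OF inj_on_edge]) auto
  also have "edge ` {s. valid s \<and> edge s \<in> F} = F"
    using assms lattice_eq_edges by auto
  finally show ?thesis .
qed

text \<open>By monotonicity this bounds, at every time of the process, the probability that
  \<open>v\<close> has no candidates.\<close>

definition block_rate :: "int \<Rightarrow> real" where
  "block_rate v = union_expect (\<lambda>X. blocked X v / real n)"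

lemma block_rate_nonneg: "0 \<le> block_rate v"
  unfolding block_rate_def union_expect_def expect_def
  by (intro integral_nonneg_AE) (auto simp: blocked_nonneg)

text \<open>The sum stays bounded because the expected degree sum is linear in \<open>n\<close>; an
  average vertex is blocked with probability \<open>O(1 / n)\<close>.\<close>

lemma sum_block_rate: "(\<Sum>v\<in>V. block_rate v) \<le> 2 * real m + 1 + c\<^sub>1"
proof -
  have "(\<Sum>v\<in>V. blocked X v / real n) = (2 * real m + 1) + 1 / real n * deg_sum X" for X
    using n_pos unfolding sum_divide_distrib [symmetric]
    by (simp add: blocked_def sum.distrib deg_sum_def field_simps)
  then have "(\<Sum>v\<in>V. block_rate v) = (2 * real m + 1) + 1 / real n * union_expect deg_sum"
    unfolding block_rate_def union_expect_sum [symmetric]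
    by (simp only: union_expect_add union_expect_cmult union_expect_const)
  also have "\<dots> \<le> (2 * real m + 1) + 1 / real n * (c\<^sub>1 * real n)"
    by (intro add_left_mono mult_left_mono union_expect_deg_sum) auto
  finally show ?thesis using n_pos by simp
qed

lemma triangle_prob:
  assumes t: "(a, b, c) \<in> triangles L"
  defines "P \<equiv> expect schedule (\<lambda>G. of_bool ((a, b, c) \<in> triangles G))"
  shows "(1 - p) ^ 3 \<le> P"
    and "P \<le> (1 - p) ^ 3 + real m * (block_rate a + block_rate b + block_rate c)"
proof -
  define F where "F = {{a, b}, {b, c}, {c, a}}"
  let ?xs = "filter (\<lambda>s. edge s \<in> F) schedule"
  have d: "a \<in> V" "b \<in> V" "c \<in> V" "a \<noteq> b" "b \<noteq> c" "c \<noteq> a" and F: "F \<subseteq> L"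
    using t by (auto simp: triangles_def F_def)
  have len: "length ?xs = 3"
    using d by (simp add: length_filter_edges F) (auto simp: F_def card_insert_if doubleton_eq_iff)
  have P: "P = subset_prob schedule F"
    using d by (simp add: P_def subset_prob_def triangles_def F_def)
  show "(1 - p) ^ 3 \<le> P"
    using subset_prob_ge [OF _ F, of schedule] by (simp add: P len set_schedule)
  have "P \<le> (1 - p) ^ 3 + (\<Sum>s\<leftarrow>?xs. block_rate (fst s))"
    using subset_prob_le [OF _ F, of schedule "[]"]
    by (simp add: P len set_schedule block_rate_def union_expect_def)
  also have "(\<Sum>s\<leftarrow>?xs. block_rate (fst s)) = (\<Sum>s\<in>set ?xs. block_rate (fst s))"
    by (simp add: sum_list_distinct_conv_sum_set distinct_schedule)
  also have "\<dots> \<le> (\<Sum>s\<in>{a, b, c} \<times> {1..int m}. block_rate (fst s))"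
  proof (rule sum_mono2)
    show "set ?xs \<subseteq> {a, b, c} \<times> {1..int m}"
    proof
      fix s assume "s \<in> set ?xs"
      then have "valid s" "fst s \<in> edge s" "edge s \<in> F"
        by (auto simp: set_schedule edge_def)
      then show "s \<in> {a, b, c} \<times> {1..int m}"
        by (cases s) (auto simp: F_def valid_def)
    qed
  qed (auto simp: block_rate_nonneg)
  also have "\<dots> = (\<Sum>v\<in>{a, b, c}. \<Sum>d\<in>{1..int m}. block_rate v)"
    unfolding sum.cartesian_product by (rule sum.cong) auto
  also have "\<dots> = real m * (block_rate a + block_rate b + block_rate c)"
    using d by (simp add: distrib_left)
  finally show "P \<le> (1 - p) ^ 3 + real m * (block_rate a + block_rate b + block_rate c)"
    by simp
qed

subsection \<open>Counting lattice triangles\<close>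

text \<open>These are the shapes of lattice triangles \<open>a\<close>, \<open>a + x\<close>,
  \<open>a + x + y\<close>; the third side has offset \<open>x + y\<close>.\<close>

definition offset_pairs :: "(int \<times> int) set" where
  "offset_pairs = {(x, y). x \<in> offsets \<and> y \<in> offsets \<and> x + y \<in> offsets}"

lemma finite_offsets [simp]: "finite offsets"
  by (simp add: offsets_def)

lemma card_compatible_offsets:
  assumes "x \<in> offsets"
  shows "real (card {y \<in> offsets. x + y \<in> offsets}) = 2 * real m - 1 - \<bar>real_of_int x\<bar>"
proof -
  have x: "x \<noteq> 0" "\<bar>x\<bar> \<le> int m" using assms by (auto simp: offsets_def)
  \<comment> \<open>Both \<open>y\<close> and \<open>x + y\<close> lie in \<open>{- m..m}\<close> on
    an interval of \<open>2 * m + 1 - \<bar>x\<bar>\<close> integers; \<open>0\<close> and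
    \<open>- x\<close> are two distinct points of it and must be removed.\<close>
  have "{y \<in> offsets. x + y \<in> offsets} = {- int m - min x 0..int m - max x 0} - {0, - x}"
    by (auto simp: offsets_def)
  also have "card \<dots> = card {- int m - min x 0..int m - max x 0} - card {0, - x}"
    using x by (intro card_Diff_subset) auto
  also have "card {0, - x} = 2" using x by simp
  finally have "card {y \<in> offsets. x + y \<in> offsets} = nat (2 * int m + 1 - \<bar>x\<bar>) - 2"
    by (simp add: min_def max_def abs_if algebra_simps split: if_splits)
  with x show ?thesis by linarith
qed

lemma card_offset_pairs: "real (card offset_pairs) = 3 * real m * (real m - 1)"
proof -
  let ?f = "\<lambda>x. 2 * real m - 1 - \<bar>real_of_int x\<bar>"
  have "offset_pairs = Sigma offsets (\<lambda>x. {y \<in> offsets. x + y \<in> offsets})"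
    by (auto simp: offset_pairs_def)
  then have "real (card offset_pairs) = (\<Sum>x\<in>offsets. real (card {y \<in> offsets. x + y \<in> offsets}))"
    by simp
  also have "\<dots> = (\<Sum>x\<in>offsets. ?f x)"
    by (intro sum.cong refl card_compatible_offsets)
  also have "offsets = int ` {1..m} \<union> (\<lambda>i. - int i) ` {1..m}" (is "_ = ?A \<union> ?B")
  proof -
    have "x \<in> ?A \<union> ?B" if "x \<in> offsets" for x
    proof (cases "0 < x")
      case True
      with that show ?thesis by (intro UnI1 image_eqI [of _ _ "nat x"]) (auto simp: offsets_def)
    next
      case False
      with that show ?thesis by (intro UnI2 image_eqI [of _ _ "nat (- x)"]) (auto simp: offsets_def)
    qed
    moreover have "?A \<union> ?B \<subseteq> offsets" by (auto simp: offsets_def)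
    ultimately show ?thesis by blast
  qed
  also have "sum ?f (?A \<union> ?B) = sum ?f ?A + sum ?f ?B"
    by (rule sum.union_disjoint) auto
  also have "\<dots> = 2 * (\<Sum>i = 1..m. 2 * real m - 1 - real i)"
    by (simp add: sum.reindex inj_on_def)
  also have "(\<Sum>i = 1..m. 2 * real m - 1 - real i) = (\<Sum>i = 1..m. 2 * real m - 1) - (\<Sum>i = 1..m. real i)"
    by (rule sum_subtractf)
  also have "\<dots> = real m * (2 * real m - 1) - real m * (real m + 1) / 2"
    using double_gauss_sum_from_Suc_0 [of m, where ?'a = real] by (simp add: field_simps)
  finally show ?thesis by (simp add: field_simps)
qed

text \<open>Reading offsets along the sides is a bijection with the shapes. Both directions rest on
  the fact that small integers congruent modulo \<open>n\<close> are equal.\<close>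

lemma card_lattice_triangles_at:
  assumes a: "a \<in> V"
  shows "card {(b, c). (a, b, c) \<in> triangles L} = card offset_pairs"
proof -
  let ?f = "\<lambda>(x, y). (wrap n (a + x), wrap n (a + x + y))"
  have n_int: "3 * int m < int n" using n_large by linarith
  have "bij_betw ?f offset_pairs {(b, c). (a, b, c) \<in> triangles L}"
  proof (rule bij_betwI')
    fix s t assume "s \<in> offset_pairs" "t \<in> offset_pairs"
    then obtain x y x' y' where st: "s = (x, y)" "t = (x', y')"
      and o: "x \<in> offsets" "y \<in> offsets" "x' \<in> offsets" "y' \<in> offsets"
      by (auto simp: offset_pairs_def)
    show "?f s = ?f t \<longleftrightarrow> s = t"
    proof
      assume "?f s = ?f t"
      then have "wrap n (a + x) = wrap n (a + x')" "wrap n (a + x + y) = wrap n (a + x' + y')"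
        by (auto simp: st)
      moreover have "\<bar>(a + x) - (a + x')\<bar> < int n" "\<bar>(a + x + y) - (a + x + y')\<bar> < int n"
        using o n_int by (auto simp: offsets_def abs_less_iff)
      moreover from calculation have "x = x'"
        using wrap_eqD [of n "a + x" "a + x'"] by simp
      ultimately have "y = y'"
        using wrap_eqD [of n "a + x + y" "a + x' + y'"] by simp
      with \<open>x = x'\<close> show "s = t" by (simp add: st)
    qed simp
  next
    fix s assume "s \<in> offset_pairs"
    then obtain x y where s: "s = (x, y)" and o: "x \<in> offsets" "y \<in> offsets" "x + y \<in> offsets"
      by (auto simp: offset_pairs_def)
    define b c where "b = wrap n (a + x)" and "c = wrap n (a + x + y)"
    have c: "c = wrap n (b + y)" "c = wrap n (a + (x + y))"
      by (simp_all add: b_def c_def wrap_wrap_add add.assoc)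
    have V: "b \<in> V" "c \<in> V" by (simp_all add: b_def c_def)
    have "b \<noteq> a" "c \<noteq> a" "c \<noteq> b"
      using offset_ne [OF a o(1)] offset_ne [OF a o(3)] offset_ne [OF V(1) o(2)] b_def c by auto
    moreover have "{a, b} \<in> L" "{b, c} \<in> L" "{a, c} \<in> L"
      using lattice_edge_iff a V o b_def c by metis+
    ultimately have "(a, b, c) \<in> triangles L"
      using a V by (simp add: triangles_def insert_commute)
    then show "?f s \<in> {(b, c). (a, b, c) \<in> triangles L}"
      by (simp add: s b_def c_def)
  next
    fix t assume "t \<in> {(b, c). (a, b, c) \<in> triangles L}"
    then obtain b c where t: "t = (b, c)" and V: "b \<in> V" "c \<in> V"
      and e: "{a, b} \<in> L" "{b, c} \<in> L" "{a, c} \<in> L"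
      by (auto simp: triangles_def insert_commute)
    obtain x where x: "x \<in> offsets" "b = wrap n (a + x)"
      using e(1) lattice_edge_iff [OF a V(1)] by blast
    obtain y where y: "y \<in> offsets" "c = wrap n (b + y)"
      using e(2) lattice_edge_iff [OF V] by blast
    obtain z where z: "z \<in> offsets" "c = wrap n (a + z)"
      using e(3) lattice_edge_iff [OF a V(2)] by blast
    have c: "c = wrap n (a + x + y)"
      unfolding y(2) x(2) by (rule wrap_wrap_add)
    \<comment> \<open>The difference is at most \<open>3 * m\<close>. This is the point that needs
      \<open>n_large\<close> in full strength: for \<open>n = 3 * m\<close>, three steps of length
      \<open>m\<close> would close up around the ring.\<close>
    have "\<bar>(a + x + y) - (a + z)\<bar> < int n"
      using z(1) x(1) y(1) n_int by (auto simp: offsets_def abs_less_iff)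
    moreover have "wrap n (a + x + y) = wrap n (a + z)"
      using c z(2) by (rule subst)
    ultimately have "a + x + y = a + z"
      by (metis wrap_eqD)
    then have "x + y \<in> offsets" using z(1) by simp
    then have "(x, y) \<in> offset_pairs"
      using x(1) y(1) by (simp add: offset_pairs_def)
    moreover have "t = ?f (x, y)"
      unfolding t prod.case c [symmetric] x(2) [symmetric] by (rule refl)
    ultimately show "\<exists>s\<in>offset_pairs. t = ?f s" by blast
  qed
  then show ?thesis by (rule bij_betw_same_card [symmetric])
qed

text \<open>Every vertex is the first corner equally often. Rotating the triples transfers this to
  the other two corners.\<close>

lemma sum_lattice_triangles:
  fixes f :: "int \<Rightarrow> real"
  shows "(\<Sum>(a, b, c)\<in>triangles L. f a) = real (card offset_pairs) * (\<Sum>v\<in>V. f v)"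
    and "(\<Sum>(a, b, c)\<in>triangles L. f b) = real (card offset_pairs) * (\<Sum>v\<in>V. f v)"
    and "(\<Sum>(a, b, c)\<in>triangles L. f c) = real (card offset_pairs) * (\<Sum>v\<in>V. f v)"
proof -
  let ?S = "\<lambda>a. {(b, c). (a, b, c) \<in> triangles L}"
  have fin: "finite (?S a)" for a
    by (rule finite_subset [of _ "V \<times> V"]) (auto simp: triangles_def)
  have "triangles L = Sigma V ?S" by (auto simp: triangles_def)
  then have "(\<Sum>(a, b, c)\<in>triangles L. f a) = (\<Sum>t\<in>Sigma V ?S. f (fst t))"
    by (auto intro!: sum.cong)
  also have "\<dots> = (\<Sum>a\<in>V. \<Sum>t\<in>?S a. f a)"
    using fin by (subst sum.Sigma) (auto intro!: sum.cong)
  also have "\<dots> = (\<Sum>a\<in>V. real (card offset_pairs) * f a)"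
    by (intro sum.cong) (auto simp: card_lattice_triangles_at)
  finally show a: "(\<Sum>(a, b, c)\<in>triangles L. f a) = real (card offset_pairs) * (\<Sum>v\<in>V. f v)"
    by (simp add: sum_distrib_left)
  have "(\<Sum>(a, b, c)\<in>triangles L. f b) = (\<Sum>(a, b, c)\<in>triangles L. f a)"
    by (rule sum.reindex_bij_witness
        [of _ "\<lambda>(a, b, c). (c, a, b)" "\<lambda>(a, b, c). (b, c, a)"]) (auto simp: triangles_def)
  with a show b: "(\<Sum>(a, b, c)\<in>triangles L. f b) = real (card offset_pairs) * (\<Sum>v\<in>V. f v)"
    by simp
  have "(\<Sum>(a, b, c)\<in>triangles L. f c) = (\<Sum>(a, b, c)\<in>triangles L. f a)"
    by (rule sum.reindex_bij_witness
        [of _ "\<lambda>(a, b, c). (b, c, a)" "\<lambda>(a, b, c). (c, a, b)"]) (auto simp: triangles_def)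
  with a show "(\<Sum>(a, b, c)\<in>triangles L. f c) = real (card offset_pairs) * (\<Sum>v\<in>V. f v)"
    by simp
qed

subsection \<open>The third moment\<close>

text \<open>The lattice has no loops, and a new endpoint avoids the window, which contains the
  vertex itself.\<close>

lemma process_loopfree:
  assumes "\<forall>s\<in>set xs. valid s" "G \<in> set_pmf (process xs)"
  shows "{v} \<notin> G"
  using assms
proof (induction xs arbitrary: G rule: rev_induct)
  case Nil
  then show ?case by (simp add: process_Nil lattice_loopfree)
next
  case (snoc s xs)
  then obtain H where H: "H \<in> set_pmf (process xs)" "G \<in> set_pmf (rewire_step n k p (fst s) (snd s) H)"
    by (auto simp: process_snoc)
  have "{v} \<notin> H" using snoc H(1) by simp
  moreover have "G = H \<or> (\<exists>j\<in>candidates n k H (fst s). G = rewired H s j)"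
  proof (cases "candidates n k H (fst s) = {}")
    case False
    then show ?thesis
      using H(2) set_pmf_of_set [OF False]
      by (auto simp: rewire_step_def rewired_def edge_def split: if_splits)
  qed (use H(2) in \<open>auto simp: rewire_step_def\<close>)
  moreover have "j \<noteq> fst s" if "j \<in> candidates n k H (fst s)" for j
    using that in_lattice_window [of "fst s"] snoc.prems(1) by (auto simp: candidates_def valid_def)
  ultimately show ?case
    by (auto simp: rewired_def)
qed

lemma expect_card_triangles:
  defines "T \<equiv> expect schedule (\<lambda>G. real (card (triangles G)))"
    and "N \<equiv> real n * real (card offset_pairs) * (1 - p) ^ 3"
  shows "N \<le> T" and "T \<le> N + (3 * real m * real (card offset_pairs) * (2 * real m + 1 + c\<^sub>1) + c\<^sub>3)"
proof -
  let ?K = "real (card offset_pairs)"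
  define P where "P = (\<lambda>t. expect schedule (\<lambda>G. of_bool (t \<in> triangles G)))"
  \<comment> \<open>Lattice triangles that survive are separated from those with a rewired edge: the
    former give the limit, the latter only an error.\<close>
  have split: "real (card (triangles G))
      = (\<Sum>t\<in>triangles L. of_bool (t \<in> triangles G)) + real (card (triangles G - triangles L))" for G
  proof -
    have "card (triangles G) = card (triangles L \<inter> triangles G) + card (triangles G - triangles L)"
      by (subst Int_commute) (rule card_Int_Diff, simp)
    then show ?thesis by (simp add: sum_of_bool_eq)
  qed
  have T: "T = (\<Sum>t\<in>triangles L. P t) + expect schedule (\<lambda>G. real (card (triangles G - triangles L)))"
    unfolding T_def split expect_add expect_sum P_def ..
  have const: "(\<Sum>t\<in>triangles L. (1 - p) ^ 3) = N"
    using sum_lattice_triangles(1) [of "\<lambda>_. (1 - p) ^ 3"] by (simp add: N_def case_prod_beta mult_ac)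
  have "N \<le> (\<Sum>t\<in>triangles L. P t)"
    unfolding const [symmetric] by (rule sum_mono) (auto simp: P_def triangle_prob(1))
  moreover have "0 \<le> expect schedule (\<lambda>G. real (card (triangles G - triangles L)))"
    unfolding expect_def by (intro integral_nonneg_AE) auto
  ultimately show "N \<le> T" by (simp add: T)
  have "(\<Sum>t\<in>triangles L. P t) \<le> (\<Sum>(a, b, c)\<in>triangles L.
      (1 - p) ^ 3 + real m * (block_rate a + block_rate b + block_rate c))"
    by (rule sum_mono) (use triangle_prob(2) in \<open>auto simp: P_def\<close>)
  also have "\<dots> = N + real m * ((\<Sum>(a, b, c)\<in>triangles L. block_rate a) +
      (\<Sum>(a, b, c)\<in>triangles L. block_rate b) + (\<Sum>(a, b, c)\<in>triangles L. block_rate c))"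
    unfolding const [symmetric] sum_distrib_left sum.distrib [symmetric]
    by (rule sum.cong) auto
  also have "\<dots> = N + 3 * real m * ?K * (\<Sum>v\<in>V. block_rate v)"
    unfolding sum_lattice_triangles by simp
  also have "\<dots> \<le> N + 3 * real m * ?K * (2 * real m + 1 + c\<^sub>1)"
    by (intro add_left_mono mult_left_mono sum_block_rate) auto
  finally have 1: "(\<Sum>t\<in>triangles L. P t) \<le> \<dots>" .
  have "expect schedule (\<lambda>G. real (card (triangles G - triangles L))) \<le> union_expect new_triangles"
    unfolding union_expect_def new_triangles_def
    by (intro expect_mono of_nat_mono card_mono Diff_mono triangles_mono) auto
  then show "T \<le> N + (3 * real m * ?K * (2 * real m + 1 + c\<^sub>1) + c\<^sub>3)"
    using 1 union_expect_new_triangles by (simp add: T)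
qed

lemma trace_cube_eq_card_triangles:
  assumes "G \<in> set_pmf (process schedule)"
  shows "mat_trace (adjacency_matrix n G ^\<^sub>m 3) = real (card (triangles G))"
proof -
  have "{v} \<notin> G" for v
    using process_loopfree [OF _ assms] by (simp add: set_schedule)
  then have "triangles G = {(a, b, c) \<in> V \<times> V \<times> V. {a, b} \<in> G \<and> {b, c} \<in> G \<and> {c, a} \<in> G}"
    by (auto simp: triangles_def)
  then show ?thesis by (simp add: trace_adjacency_cube)
qed

lemma third_moment_bound:
  "\<bar>measure_pmf.expectation (small_world n k p) (\<lambda>G. 1 / real n * mat_trace (adjacency_matrix n G ^\<^sub>m 3))
      - 3 * real m * (real m - 1) * (1 - p) ^ 3\<bar>
    \<le> (9 * (real m)\<^sup>2 * (real m - 1) * (2 * real m + 1 + c\<^sub>1) + c\<^sub>3) / real n"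
proof -
  let ?T = "expect schedule (\<lambda>G. real (card (triangles G)))"
  let ?N = "real n * real (card offset_pairs) * (1 - p) ^ 3"
  let ?M = "measure_pmf.expectation (small_world n k p)
    (\<lambda>G. 1 / real n * mat_trace (adjacency_matrix n G ^\<^sub>m 3))"
  have "?M = 1 / real n * expect schedule (\<lambda>G. mat_trace (adjacency_matrix n G ^\<^sub>m 3))"
    unfolding small_world_eq expect_def [symmetric] expect_cmult ..
  also have "expect schedule (\<lambda>G. mat_trace (adjacency_matrix n G ^\<^sub>m 3)) = ?T"
    by (rule expect_cong) (rule trace_cube_eq_card_triangles)
  finally have "?M - 3 * real m * (real m - 1) * (1 - p) ^ 3
      = 1 / real n * ?T - 3 * real m * (real m - 1) * (1 - p) ^ 3"
    by (rule arg_cong)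
  also have "\<dots> = (?T - ?N) / real n"
    using n_pos by (simp add: card_offset_pairs diff_divide_distrib)
  \<comment> \<open>The absolute value disappears because the lower bound \<open>?N \<le> ?T\<close>
    holds without error.\<close>
  finally have "\<bar>?M - 3 * real m * (real m - 1) * (1 - p) ^ 3\<bar> = (?T - ?N) / real n"
    using expect_card_triangles(1) by simp
  also have "\<dots> \<le> (9 * (real m)\<^sup>2 * (real m - 1) * (2 * real m + 1 + c\<^sub>1) + c\<^sub>3) / real n"
    using expect_card_triangles(2) unfolding card_offset_pairs
    by (intro divide_right_mono) (auto simp: power2_eq_square mult_ac)
  finally show ?thesis .
qed

end

theorem theorem3p11:
  fixes k :: nat and p :: real
  assumes "even k" and "p \<in> {0..1}"
  shows "(\<lambda>n. measure_pmf.expectation (small_world n k p)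
             (\<lambda>G. 1 / real n * mat_trace (adjacency_matrix n G ^\<^sub>m 3)))
           \<longlonglongrightarrow> 3 * real k * (real k - 2) * (1 - p) ^ 3 / 4"
proof -
  define m where "m = k div 2"
  \<comment> \<open>Outside the locale the constants take \<open>k\<close> as their only argument,
    so \<open>K\<close> does not change with \<open>n\<close>.\<close>
  define K where "K = 9 * (real m)\<^sup>2 * (real m - 1) * (2 * real m + 1 + small_world_process.c\<^sub>1 k)
    + small_world_process.c\<^sub>3 k"
  let ?M = "\<lambda>n. measure_pmf.expectation (small_world n k p)
    (\<lambda>G. 1 / real n * mat_trace (adjacency_matrix n G ^\<^sub>m 3))"
  let ?l = "3 * real m * (real m - 1) * (1 - p) ^ 3"
  have bound: "\<bar>?M n - ?l\<bar> \<le> K / real n" if "3 * m < n" for n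
  proof -
    interpret small_world_process n k p
      using that assms by unfold_locales (auto simp: m_def)
    show ?thesis
      using third_moment_bound unfolding K_def m_def .
  qed
  have "(\<lambda>n. ?M n - ?l) \<longlonglongrightarrow> 0"
  proof (rule Lim_null_comparison)
    show "\<forall>\<^sub>F n in sequentially. norm (?M n - ?l) \<le> K / real n"
      using eventually_gt_at_top [of "3 * m"] by eventually_elim (simp only: real_norm_def bound)
    show "(\<lambda>n. K / real n) \<longlonglongrightarrow> 0"
      by (rule lim_const_over_n)
  qed
  then have "?M \<longlonglongrightarrow> ?l" by (rule LIM_zero_cancel)
  moreover have "real k = 2 * real m"
    using assms(1) by (auto simp: m_def)
  then have "?l = 3 * real k * (real k - 2) * (1 - p) ^ 3 / 4"
    by (simp add: algebra_simps)
  ultimately show ?thesis by simp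
qed

end
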